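(* Consider the affine-quadratic control problem: for $k\in K=\{1,\dots,T\}$ the state evolves by $$x_{k+1}=f_k(x_k,u_k)=A_kx_k+B_ku_k+c_k,$$ with $x_1$ given, and the cost to be minimized is $$L(u)=\sum_{k=1}^Tg_k(x_{k+1},u_k,x_k),\qquad g_k(x_{k+1},u_k,x_k)=\tfrac12\big(x_{k+1}'Q_{k+1}x_{k+1}+u_k'R_ku_k\big).$$ This problem admits a unique control solution if $Q_k\ge0$ and $R_k>0$ for $k\in K$. If these conditions are satisfied, the unique optimal strategies are $$\gamma_k(x_k)=-P_k^*x_k-\alpha_k^*,\qquad k\in K,$$ where $$P_k^*=(R_k+B_k'Z_{k+1}B_k)^{-1}B_k'Z_{k+1}A_k,$$ $$\alpha_k^*=(R_k+B_k'Z_{k+1}B_k)^{-1}B_k'(Z_{k+1}c_k+\zeta_{k+1}),$$ $$Z_k=(A_k-B_kP_k^* )'Z_{k+1}(A_k-B_kP_k^* )+P_k^{*'}R_kP_k^*+Q_k,\qquad Z_{T+1}=Q_{T+1},$$ $$\zeta_k=(A_k-B_kP_k^* )'[\zeta_{k+1}+Z_{k+1}(c_k-B_k\alpha_k^* )]+P_k^{*'}R_k\alpha_k^*,\qquad \zeta_{T+1}=0.$$ The corresponding minimum value is $$V(1,x_1)=\tfrac12x_1'Z_1x_1+\zeta_1'x_1+n_1,$$ where $$n_k=n_{k+1}+\tfrac12(c_k-B_k\alpha_k^* )'Z_{k+1}(c_k-B_k\alpha_k^* )+\zeta_{k+1}'(c_k-B_k\alpha_k^* )+\tfrac12\alpha_k^{*'}R_k\alpha_k^*,\qquad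 n_{T+1}=0.$$
   Context: A prime denotes transpose; for symmetric matrices $>0$ means positive definite and $\ge0$ positive semidefinite. $T$ is the fixed number of stages. States $x_k\in\mathbb R^p$, controls $u_k\in\mathbb R^m$, $u=(u_1,\dots,u_T)$; $A_k,B_k,c_k,Q_k,R_k$ are given matrices and vectors of appropriate dimensions, with $Q_k,R_k$ symmetric. Strategies are of feedback type, $u_k=\gamma_k(x_k)$. $V(k,x)$ denotes the minimal cost from stage $k$ onward starting at $x_k=x$, with $V(T+1,\cdot)=0$; strategies are optimal if, for all $k$ and $x$, $\gamma_k(x)$ minimizes over $u_k$ the sum of the stage cost at $k$ and $V(k+1,A_kx+B_ku_k+c_k)$.
   Formalization: Q_k≥0 is assumed also for k=T+1 (otherwise the cost can be unbounded below), and since the cost never charges Q_1, the minimum value is stated with the extra term −½x_1'Q_1x_1, so the printed formula is asserted for Q_1=0. *)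

theory Defs
  imports "HOL-Analysis.Analysis"
begin

definition pos_def :: "real^'n^'n \<Rightarrow> bool" where
  "pos_def M \<longleftrightarrow> transpose M = M \<and> (\<forall>x. x \<noteq> 0 \<longrightarrow> x \<bullet> (M *v x) > 0)"

definition pos_semidef :: "real^'n^'n \<Rightarrow> bool" where
  "pos_semidef M \<longleftrightarrow> transpose M = M \<and> (\<forall>x. x \<bullet> (M *v x) \<ge> 0)"

text \<open>
  \<open>state_from f k x u j\<close> is the state at stage \<open>j\<close> of the trajectory that is at \<open>x\<close> at stage \<open>k\<close>
  and is driven by the controls \<open>u\<close>. Only \<open>j \<ge> k\<close> is meaningful (for \<open>j < k\<close> the value is \<open>x\<close>).
\<close>
primrec state_from ::
    "(nat \<Rightarrow> 'x \<Rightarrow> 'u \<Rightarrow> 'x) \<Rightarrow> nat \<Rightarrow> 'x \<Rightarrow> (nat \<Rightarrow> 'u) \<Rightarrow> nat \<Rightarrow> 'x" where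
  "state_from f k x u 0 = x"
| "state_from f k x u (Suc j) = (if Suc j \<le> k then x else f j (state_from f k x u j) (u j))"

text \<open>
  The arguments of the stage cost \<open>g j\<close> are the next state, the control and the current state,
  in this order.
\<close>
definition cost_from ::
    "(nat \<Rightarrow> 'x \<Rightarrow> 'u \<Rightarrow> 'x) \<Rightarrow> (nat \<Rightarrow> 'x \<Rightarrow> 'u \<Rightarrow> 'x \<Rightarrow> real) \<Rightarrow> nat \<Rightarrow> nat \<Rightarrow> 'x \<Rightarrow> (nat \<Rightarrow> 'u) \<Rightarrow> real" where
  "cost_from f g T k x u =
     (\<Sum>j=k..T. g j (state_from f k x u (j + 1)) (u j) (state_from f k x u j))"

text \<open>
  A control for the stages \<open>k, \<dots>, T\<close> is an extensional function on \<open>{k..T}\<close>, so that two controls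
  are equal iff they agree on these stages.
\<close>
abbreviation controls :: "nat \<Rightarrow> nat \<Rightarrow> (nat \<Rightarrow> 'u) set" where
  "controls k T \<equiv> {k..T} \<rightarrow>\<^sub>E UNIV"

definition optimal_control ::
    "(nat \<Rightarrow> 'x \<Rightarrow> 'u \<Rightarrow> 'x) \<Rightarrow> (nat \<Rightarrow> 'x \<Rightarrow> 'u \<Rightarrow> 'x \<Rightarrow> real) \<Rightarrow> nat \<Rightarrow> 'x \<Rightarrow> (nat \<Rightarrow> 'u) \<Rightarrow> bool" where
  "optimal_control f g T x1 u \<longleftrightarrow>
     is_arg_min (cost_from f g T 1 x1) (\<lambda>v. v \<in> controls 1 T) u"

definition value_fn ::
    "(nat \<Rightarrow> 'x \<Rightarrow> 'u \<Rightarrow> 'x) \<Rightarrow> (nat \<Rightarrow> 'x \<Rightarrow> 'u \<Rightarrow> 'x \<Rightarrow> real) \<Rightarrow> nat \<Rightarrow> nat \<Rightarrow> 'x \<Rightarrow> real" where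
  "value_fn f g T k x = (INF u\<in>controls k T. cost_from f g T k x u)"

lemma value_fn_terminal: "value_fn f g T (T + 1) x = 0"
  by (simp add: value_fn_def cost_from_def)

definition optimal_strategies ::
    "(nat \<Rightarrow> 'x \<Rightarrow> 'u \<Rightarrow> 'x) \<Rightarrow> (nat \<Rightarrow> 'x \<Rightarrow> 'u \<Rightarrow> 'x \<Rightarrow> real) \<Rightarrow> nat \<Rightarrow> (nat \<Rightarrow> 'x \<Rightarrow> 'u) \<Rightarrow> bool" where
  "optimal_strategies f g T \<gamma> \<longleftrightarrow>
     (\<forall>k\<in>{1..T}. \<forall>x.
        is_arg_min (\<lambda>v. g k (f k x v) v x + value_fn f g T (k + 1) (f k x v)) (\<lambda>_. True) (\<gamma> k x))"

definition affine_dyn ::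
    "(nat \<Rightarrow> real^'p^'p) \<Rightarrow> (nat \<Rightarrow> real^'m^'p) \<Rightarrow> (nat \<Rightarrow> real^'p) \<Rightarrow>
     nat \<Rightarrow> real^'p \<Rightarrow> real^'m \<Rightarrow> real^'p" where
  "affine_dyn A B c k x u = A k *v x + B k *v u + c k"

definition quadratic_cost ::
    "(nat \<Rightarrow> real^'p^'p) \<Rightarrow> (nat \<Rightarrow> real^'m^'m) \<Rightarrow>
     nat \<Rightarrow> real^'p \<Rightarrow> real^'m \<Rightarrow> real^'p \<Rightarrow> real" where
  "quadratic_cost Q R k y u x = 1/2 * (y \<bullet> (Q (k + 1) *v y) + u \<bullet> (R k *v u))"

end

theory Submission
  imports Defs
begin

text \<open>
  Subtracting \<open>x'Q\<^sub>k x / 2\<close>, which the paper's cost does not charge at the initial state, from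
  \<open>x'Z\<^sub>k x / 2 + \<zeta>\<^sub>k'x + n\<^sub>k\<close> gives a function \<open>W\<^sub>k\<close> that solves the Bellman equation: completing the
  square, the stage cost plus \<open>W\<^sub>k\<^sub>+\<^sub>1\<close> equals \<open>W\<^sub>k(x) + h'(R\<^sub>k + B\<^sub>k'Z\<^sub>k\<^sub>+\<^sub>1B\<^sub>k)h / 2\<close>, where \<open>h\<close> is the
  deviation of the control from the feedback law. The matrix of this form is positive definite
  because every \<open>Z\<^sub>k\<close> is positive semidefinite, so the cost along a trajectory is at least \<open>W\<close>, with
  equality exactly for the closed-loop control.
\<close>

section \<open>Verification by a solution of the Bellman equation\<close>

lemma state_from_start [simp]: "state_from f k x u k = x"
  by (cases k) auto

lemma state_from_step:
  "k \<le> j \<Longrightarrow> state_from f k x u (Suc j) = f j (state_from f k x u j) (u j)"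
  by simp

text \<open>Semigroup property of the dynamics: it lets the cost and the feedback condition be
  peeled off one stage at a time, with the start state moving along.\<close>

lemma state_from_shift:
  "Suc k \<le> j \<Longrightarrow> state_from f k x u j = state_from f (Suc k) (f k x (u k)) u j"
  by (induction j rule: dec_induct) auto

lemma cost_from_unfold:
  assumes "k \<le> T"
  shows "cost_from f g T k x u =
    g k (f k x (u k)) (u k) x + cost_from f g T (Suc k) (f k x (u k)) u"
proof -
  have "(\<Sum>j=Suc k..T. g j (state_from f k x u (j + 1)) (u j) (state_from f k x u j))
      = (\<Sum>j=Suc k..T. g j (state_from f (Suc k) (f k x (u k)) u (j + 1)) (u j)
          (state_from f (Suc k) (f k x (u k)) u j))"
    by (intro sum.cong refl) (simp add: state_from_shift del: state_from.simps)
  then show ?thesis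
    using assms unfolding cost_from_def
    by (subst sum.atLeast_Suc_atMost) (simp_all add: state_from_step del: state_from.simps)
qed

text \<open>The left condition is implicit, since the states depend on \<open>u\<close> itself. On
  the right the closed-loop dynamics ignore their control argument, so the trajectory is fixed in
  advance, \<open>w\<close> is arbitrary, and \<open>u\<close> is prescribed explicitly.\<close>

lemma follows_feedback_iff:
  fixes u w :: "nat \<Rightarrow> 'u"
  shows "(\<forall>j\<in>{k..T}. u j = \<gamma> j (state_from f k x u j)) \<longleftrightarrow>
   (\<forall>j\<in>{k..T}. u j = \<gamma> j (state_from (\<lambda>i y _. f i y (\<gamma> i y)) k x w j))"
  (is "?L \<longleftrightarrow> ?R")
proof -
  let ?s = "state_from f k x u" and ?c = "state_from (\<lambda>i y _. f i y (\<gamma> i y)) k x w"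
  \<comment> \<open>Assuming only the disjunction lets one induction serve both directions.\<close>
  have "?s j = ?c j" if "?L \<or> ?R" "k \<le> j" "j \<le> T" for j
    using that(2,3)
  proof (induction j rule: dec_induct)
    case base
    show ?case by simp
  next
    case (step i)
    then have "?s i = ?c i" "i \<in> {k..T}" by auto
    moreover from this(2) have "u i = \<gamma> i (?s i) \<or> u i = \<gamma> i (?c i)"
      using that(1) by blast
    ultimately show ?case
      using step.hyps by (auto simp: state_from_step simp del: state_from.simps)
  qed
  note agree = this
  show ?thesis
  proof
    assume ?L
    then show ?R using agree[OF disjI1[OF \<open>?L\<close>]] by simp
  next
    assume ?R
    then show ?L using agree[OF disjI2[OF \<open>?R\<close>]] by simp
  qed
qed

lemma ex1_extensional: "\<exists>!u. u \<in> A \<rightarrow>\<^sub>E UNIV \<and> (\<forall>j\<in>A. u j = w j)"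
  by (rule ex1I[of _ "restrict w A"]) (auto intro: extensionalityI simp: PiE_def)

lemma ex1_feedback_control:
  "\<exists>!u. u \<in> controls k T \<and> (\<forall>j\<in>{k..T}. u j = \<gamma> j (state_from f k x u j))"
  \<comment> \<open>\<open>undefined\<close> fills the control slot that the closed-loop dynamics
    ignore.\<close>
  unfolding follows_feedback_iff[of k T _ \<gamma> f x undefined] by (rule ex1_extensional)

lemma is_arg_min_iff_attains:
  fixes h :: "'a \<Rightarrow> 'b::linorder"
  assumes "\<And>v. S v \<Longrightarrow> c \<le> h v" "S w" "h w = c"
  shows "is_arg_min h S v \<longleftrightarrow> S v \<and> h v = c"
  unfolding is_arg_min_linorder using assms by (metis order_antisym)

text \<open>Abstract verification setting: by the last two assumptions, \<open>W k x\<close> is the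
  minimum of the Bellman expression and \<open>\<gamma> k x\<close> its only minimizer. Nothing
  affine or quadratic enters here.\<close>

context
  fixes f :: "nat \<Rightarrow> 'x \<Rightarrow> 'u \<Rightarrow> 'x" and g :: "nat \<Rightarrow> 'x \<Rightarrow> 'u \<Rightarrow> 'x \<Rightarrow> real"
    and W :: "nat \<Rightarrow> 'x \<Rightarrow> real" and \<gamma> :: "nat \<Rightarrow> 'x \<Rightarrow> 'u" and T :: nat
  assumes terminal: "\<And>x. W (Suc T) x = 0"
    and bellman_le:
      "\<And>k x v. k \<in> {1..T} \<Longrightarrow> W k x \<le> g k (f k x v) v x + W (Suc k) (f k x v)"
    and bellman_eq_iff:
      "\<And>k x v. k \<in> {1..T} \<Longrightarrow> g k (f k x v) v x + W (Suc k) (f k x v) = W k x \<longleftrightarrow> v = \<gamma> k x"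
begin

text \<open>Backward induction on the starting stage. Each stage adds a nonnegative Bellman gap,
  which vanishes only if the control there is the feedback value.\<close>

lemma cost_from_bellman:
  assumes "1 \<le> k" "k \<le> Suc T"
  shows "W k x \<le> cost_from f g T k x u \<and>
    (cost_from f g T k x u = W k x \<longleftrightarrow> (\<forall>j\<in>{k..T}. u j = \<gamma> j (state_from f k x u j)))"
  using assms(2,1)
proof (induction k arbitrary: x rule: inc_induct)
  case base
  show ?case by (simp add: cost_from_def terminal)
next
  case (step k)
  define y where "y = f k x (u k)"
  have k: "k \<in> {1..T}" using step.hyps step.prems by auto
  have cost: "cost_from f g T k x u = g k y (u k) x + cost_from f g T (Suc k) y u"
    using k by (simp add: cost_from_unfold y_def)
  have follows: "(\<forall>j\<in>{k..T}. u j = \<gamma> j (state_from f k x u j)) \<longleftrightarrow>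
      u k = \<gamma> k x \<and> (\<forall>j\<in>{Suc k..T}. u j = \<gamma> j (state_from f (Suc k) y u j))"
  proof -
    have "{k..T} = insert k {Suc k..T}" using k by auto
    moreover have "state_from f k x u j = state_from f (Suc k) y u j" if "j \<in> {Suc k..T}" for j
      using that state_from_shift[of k j f x u] by (simp add: y_def)
    ultimately show ?thesis by simp
  qed
  have IH: "W (Suc k) y \<le> cost_from f g T (Suc k) y u"
    "cost_from f g T (Suc k) y u = W (Suc k) y \<longleftrightarrow>
      (\<forall>j\<in>{Suc k..T}. u j = \<gamma> j (state_from f (Suc k) y u j))"
    using step.IH[of y] by auto
  have le: "W k x \<le> g k y (u k) x + W (Suc k) y"
    and eq: "g k y (u k) x + W (Suc k) y = W k x \<longleftrightarrow> u k = \<gamma> k x"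
    using bellman_le[OF k] bellman_eq_iff[OF k] by (auto simp: y_def)
  \<comment> \<open>The excess of the cost over \<open>W k x\<close> is the gap at stage
    \<open>k\<close> plus the excess from \<open>Suc k\<close> on; both are nonnegative, so the sum
    is zero iff both are.\<close>
  show ?case
    unfolding cost follows eq[symmetric] IH(2)[symmetric] using le IH(1) by linarith
qed

text \<open>The closed-loop control attains the lower bound \<open>W k x\<close>, so the infimum is
  a minimum. The range includes \<open>Suc T\<close>, because stage \<open>T\<close> refers to the
  value one stage later.\<close>

lemma value_fn_bellman:
  assumes "1 \<le> k" "k \<le> Suc T"
  shows "value_fn f g T k x = W k x"
proof -
  obtain u where "u \<in> controls k T" "\<forall>j\<in>{k..T}. u j = \<gamma> j (state_from f k x u j)"
    using ex1_feedback_control[of k T \<gamma> f x] by blast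
  then have "W k x = cost_from f g T k x u" "u \<in> controls k T"
    using cost_from_bellman[OF assms, of x u] by auto
  then have "W k x \<in> cost_from f g T k x ` controls k T"
    by (rule image_eqI)
  then show ?thesis
    unfolding value_fn_def using cost_from_bellman[OF assms, of x]
    by (intro cInf_eq_minimum) blast+
qed

text \<open>Optimality amounts to cost \<open>W 1 x\<close>, hence to following the feedback law,
  and exactly one extensional control does that.\<close>

lemma ex1_optimal_control: "\<exists>!u. optimal_control f g T x u"
proof -
  have *: "W 1 x \<le> cost_from f g T 1 x u"
    "cost_from f g T 1 x u = W 1 x \<longleftrightarrow> (\<forall>j\<in>{1..T}. u j = \<gamma> j (state_from f 1 x u j))" for u
    using cost_from_bellman[of 1 x u] by auto
  have ex1: "\<exists>!u. u \<in> controls 1 T \<and> cost_from f g T 1 x u = W 1 x"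
    unfolding *(2) by (rule ex1_feedback_control)
  then obtain u0 where u0: "u0 \<in> controls 1 T" "cost_from f g T 1 x u0 = W 1 x"
    by blast
  have "optimal_control f g T x u \<longleftrightarrow> u \<in> controls 1 T \<and> cost_from f g T 1 x u = W 1 x" for u
    unfolding optimal_control_def using *(1) u0 by (intro is_arg_min_iff_attains)
  then show ?thesis
    using ex1 by simp
qed

lemma optimal_strategies_iff:
  "optimal_strategies f g T \<delta> \<longleftrightarrow> (\<forall>k\<in>{1..T}. \<forall>x. \<delta> k x = \<gamma> k x)"
proof -
  have "is_arg_min (\<lambda>v. g k (f k x v) v x + value_fn f g T (k + 1) (f k x v)) (\<lambda>_. True) (\<delta> k x)
      \<longleftrightarrow> \<delta> k x = \<gamma> k x" if k: "k \<in> {1..T}" for k x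
  proof -
    have "value_fn f g T (k + 1) y = W (Suc k) y" for y
      using k value_fn_bellman[of "Suc k" y] by auto
    then show ?thesis
      using is_arg_min_iff_attains[of "\<lambda>_. True" "W k x"
          "\<lambda>v. g k (f k x v) v x + W (Suc k) (f k x v)" "\<gamma> k x" "\<delta> k x"]
        bellman_le[OF k] bellman_eq_iff[OF k] by simp
  qed
  then show ?thesis by (simp add: optimal_strategies_def)
qed

end

section \<open>Definite matrices\<close>

lemma inner_matrix_vector_mult:
  fixes M :: "real^'n^'m"
  shows "x \<bullet> (M *v y) = (transpose M *v x) \<bullet> y"
  by (simp add: dot_lmul_matrix)

lemma inner_transpose_matrix_vector_mult:
  fixes M :: "real^'n^'m"
  shows "x \<bullet> (transpose M *v y) = (M *v x) \<bullet> y"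
  by (simp only: inner_matrix_vector_mult transpose_transpose)

lemma inner_matrix_symmetric:
  fixes M :: "real^'n^'n"
  assumes "transpose M = M"
  shows "x \<bullet> (M *v y) = y \<bullet> (M *v x)"
  using inner_matrix_vector_mult[of x M y] assms by (simp only: inner_commute)

lemma quadratic_form_add:
  fixes M :: "real^'n^'n"
  assumes "transpose M = M"
  shows "(x + y) \<bullet> (M *v (x + y)) = x \<bullet> (M *v x) + 2 * (y \<bullet> (M *v x)) + y \<bullet> (M *v y)"
  using inner_matrix_symmetric[OF assms, of x y]
  by (simp add: matrix_vector_right_distrib inner_simps)

lemma transpose_add: "transpose (M + N) = transpose M + transpose (N :: real^'n^'m)"
  by (simp add: transpose_def vec_eq_iff)

lemma pos_def_imp_pos_semidef: "pos_def M \<Longrightarrow> pos_semidef M"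
  unfolding pos_def_def pos_semidef_def
  by (metis inner_zero_left order_less_imp_le order_refl)

lemma pos_semidef_add: "pos_semidef M \<Longrightarrow> pos_semidef N \<Longrightarrow> pos_semidef (M + N)"
  by (simp add: pos_semidef_def transpose_add matrix_vector_mult_add_rdistrib inner_add_right)

lemma pos_def_add_pos_semidef: "pos_def M \<Longrightarrow> pos_semidef N \<Longrightarrow> pos_def (M + N)"
  by (simp add: pos_def_def pos_semidef_def transpose_add matrix_vector_mult_add_rdistrib
      inner_add_right add_pos_nonneg)

text \<open>The form of \<open>transpose S ** M ** S\<close> at \<open>x\<close> is the form of
  \<open>M\<close> at \<open>S *v x\<close>.\<close>

lemma pos_semidef_congruence:
  fixes M :: "real^'n^'n" and S :: "real^'m^'n"
  assumes "pos_semidef M"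
  shows "pos_semidef (transpose S ** M ** S)"
  using assms unfolding pos_semidef_def
  by (simp add: matrix_transpose_mul matrix_mul_assoc inner_transpose_matrix_vector_mult
      del: transpose_matrix_vector flip: matrix_vector_mul_assoc)

lemma matrix_mult_matrix_inv:
  assumes "invertible M"
  shows "M ** matrix_inv M = mat 1"
  using assms unfolding invertible_def matrix_inv_def by (rule someI2_ex) simp

text \<open>A kernel vector makes the quadratic form vanish, so the kernel is trivial, which
  suffices for a square matrix.\<close>

lemma pos_def_imp_invertible:
  fixes M :: "real^'n^'n"
  assumes "pos_def M"
  shows "invertible M"
proof -
  have "x = 0" if "M *v x = 0" for x
    using assms that unfolding pos_def_def by (metis inner_zero_right less_irrefl)
  then show ?thesis
    by (metis invertible_left_inverse matrix_left_invertible_ker)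
qed

section \<open>The Riccati recursion\<close>

text \<open>Here \<open>v\<close> is the stationary control, \<open>y\<close> the next state it
  produces, and \<open>h\<close> a deviation from \<open>v\<close>. The terms linear in
  \<open>h\<close> are \<open>h\<close> paired with the gradient in the control, which is zero by
  \<open>stationary\<close>; only the pure square in \<open>h\<close> survives.\<close>

lemma stage_cost_complete_square:
  fixes Z :: "real^'p^'p" and R :: "real^'m^'m" and B :: "real^'m^'p"
  assumes sym: "transpose Z = Z" "transpose R = R"
    and stationary: "transpose B *v (Z *v y + \<zeta>) + R *v v = 0"
  shows "1/2 * ((y + B *v h) \<bullet> (Z *v (y + B *v h))) + \<zeta> \<bullet> (y + B *v h)
      + 1/2 * ((v + h) \<bullet> (R *v (v + h)))
    = 1/2 * (y \<bullet> (Z *v y)) + \<zeta> \<bullet> y + 1/2 * (v \<bullet> (R *v v))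
      + 1/2 * (h \<bullet> ((R + transpose B ** Z ** B) *v h))"
proof -
  have "h \<bullet> (transpose B *v (Z *v y + \<zeta>) + R *v v) = 0"
    by (simp only: stationary inner_zero_right)
  then have "(B *v h) \<bullet> (Z *v y) + \<zeta> \<bullet> (B *v h) + h \<bullet> (R *v v) = 0"
    by (simp add: inner_add_right inner_transpose_matrix_vector_mult inner_commute[of \<zeta>]
        del: transpose_matrix_vector)
  moreover have "h \<bullet> ((R + transpose B ** Z ** B) *v h)
      = h \<bullet> (R *v h) + (B *v h) \<bullet> (Z *v (B *v h))"
    by (simp add: matrix_vector_mult_add_rdistrib inner_add_right
        inner_transpose_matrix_vector_mult del: transpose_matrix_vector flip: matrix_vector_mul_assoc)
  ultimately show ?thesis
    using quadratic_form_add[OF sym(1), of y "B *v h"] quadratic_form_add[OF sym(2), of v h]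
      inner_add_right[of \<zeta> y "B *v h"]
    by linarith
qed

text \<open>Applying \<open>M\<close> to \<open>v\<close> cancels the inverse in \<open>P\<close>
  and \<open>\<alpha>\<close>; what remains is the stationarity equation rearranged.\<close>

lemma riccati_minimizer_stationary:
  fixes Z :: "real^'p^'p" and R :: "real^'m^'m" and A :: "real^'p^'p" and B :: "real^'m^'p"
  defines "M \<equiv> R + transpose B ** Z ** B"
  assumes "invertible M"
    and P: "P = matrix_inv M ** transpose B ** Z ** A"
    and \<alpha>: "\<alpha> = (matrix_inv M ** transpose B) *v (Z *v c + \<zeta>)"
    and v: "v = - (P *v x) - \<alpha>"
  shows "transpose B *v (Z *v (A *v x + B *v v + c) + \<zeta>) + R *v v = 0"
proof -
  have inv: "M *v (matrix_inv M *v w) = w" for w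
    using assms(2) by (simp add: matrix_vector_mul_assoc matrix_mult_matrix_inv)
  have "M *v v = - (M *v (P *v x)) - M *v \<alpha>"
    by (simp add: v matrix_vector_mult_diff_distrib vec.neg)
  also have "M *v (P *v x) = transpose B *v (Z *v (A *v x))"
    by (simp add: P inv flip: matrix_vector_mul_assoc)
  also have "M *v \<alpha> = transpose B *v (Z *v c + \<zeta>)"
    by (simp add: \<alpha> inv flip: matrix_vector_mul_assoc)
  finally have "R *v v + transpose B *v (Z *v (B *v v))
      = - (transpose B *v (Z *v (A *v x))) - transpose B *v (Z *v c + \<zeta>)"
    by (simp add: M_def matrix_vector_mult_add_rdistrib flip: matrix_vector_mul_assoc)
  then show ?thesis
    by (simp add: matrix_vector_right_distrib eq_neg_iff_add_eq_0 algebra_simps)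
qed

text \<open>With \<open>F = A - BP\<close> and \<open>d = c - B\<alpha>\<close>, the feedback leads
  to the next state \<open>F *v x + d\<close>. Sorting by degree in \<open>x\<close> yields the
  recursions: the quadratic part is that of \<open>Z\<close> without its \<open>Q\<close> term, the
  linear part that of \<zeta>, the constant the increment of \<open>n\<close>.\<close>

lemma riccati_minimum_value:
  fixes Z :: "real^'p^'p" and R :: "real^'m^'m" and F :: "real^'p^'p" and P :: "real^'p^'m"
  assumes sym: "transpose Z = Z" "transpose R = R"
  shows "1/2 * ((F *v x + d) \<bullet> (Z *v (F *v x + d))) + \<zeta> \<bullet> (F *v x + d)
      + 1/2 * ((- (P *v x) - \<alpha>) \<bullet> (R *v (- (P *v x) - \<alpha>)))
    = 1/2 * (x \<bullet> ((transpose F ** Z ** F + transpose P ** R ** P) *v x))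
      + (transpose F *v (\<zeta> + Z *v d) + (transpose P ** R) *v \<alpha>) \<bullet> x
      + (1/2 * (d \<bullet> (Z *v d)) + \<zeta> \<bullet> d + 1/2 * (\<alpha> \<bullet> (R *v \<alpha>)))"
proof -
  have neg: "(- (P *v x) - \<alpha>) \<bullet> (R *v (- (P *v x) - \<alpha>)) = (P *v x + \<alpha>) \<bullet> (R *v (P *v x + \<alpha>))"
  proof -
    have "- (P *v x) - \<alpha> = - (P *v x + \<alpha>)" by simp
    then show ?thesis by (simp only: vec.neg inner_minus_left inner_minus_right minus_minus)
  qed
  have "x \<bullet> ((transpose F ** Z ** F + transpose P ** R ** P) *v x)
      = (F *v x) \<bullet> (Z *v (F *v x)) + (P *v x) \<bullet> (R *v (P *v x))"
    by (simp add: matrix_vector_mult_add_rdistrib inner_add_right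
        inner_transpose_matrix_vector_mult del: transpose_matrix_vector flip: matrix_vector_mul_assoc)
  moreover have "(transpose F *v (\<zeta> + Z *v d) + (transpose P ** R) *v \<alpha>) \<bullet> x
      = \<zeta> \<bullet> (F *v x) + (Z *v d) \<bullet> (F *v x) + (R *v \<alpha>) \<bullet> (P *v x)"
    by (simp add: inner_add_left inner_matrix_vector_mult[of _ F] inner_matrix_vector_mult[of _ P]
        matrix_vector_right_distrib flip: matrix_vector_mul_assoc)
  moreover have "(Z *v d) \<bullet> (F *v x) = d \<bullet> (Z *v (F *v x))" "(R *v \<alpha>) \<bullet> (P *v x) = \<alpha> \<bullet> (R *v (P *v x))"
    using sym by (simp_all add: inner_matrix_vector_mult)
  ultimately show ?thesis
    using quadratic_form_add[OF sym(1), of "F *v x" d]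
      quadratic_form_add[OF sym(2), of "P *v x" \<alpha>] inner_add_right[of \<zeta> "F *v x" d]
    unfolding neg by linarith
qed

text \<open>Backward induction from \<open>Q (T+1)\<close>: each step adds two congruences of
  positive semidefinite matrices and \<open>Q k\<close>.\<close>

lemma riccati_pos_semidef:
  fixes Z Q F :: "nat \<Rightarrow> real^'p^'p" and R :: "nat \<Rightarrow> real^'m^'m" and P :: "nat \<Rightarrow> real^'p^'m"
  assumes Q: "\<And>k. k \<in> {1..T+1} \<Longrightarrow> pos_semidef (Q k)"
    and R: "\<And>k. k \<in> {1..T} \<Longrightarrow> pos_def (R k)"
    and Z_end: "Z (T+1) = Q (T+1)"
    and Z: "\<And>k. k \<in> {1..T} \<Longrightarrow> Z k =
      transpose (F k) ** Z (k+1) ** F k + transpose (P k) ** R k ** P k + Q k"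
    and "1 \<le> k" "k \<le> T+1"
  shows "pos_semidef (Z k)"
  using assms(6,5)
proof (induction k rule: inc_induct)
  case base
  then show ?case using Q[of "T+1"] Z_end by simp
next
  case (step k)
  then have "k \<in> {1..T}" "pos_semidef (Q k)" "pos_semidef (R k)" "pos_semidef (Z (k+1))"
    using Q R by (auto intro: pos_def_imp_pos_semidef)
  then show ?case
    unfolding Z[OF \<open>k \<in> {1..T}\<close>]
    by (intro pos_semidef_add pos_semidef_congruence)
qed

text \<open>\<open>Z 1\<close> contains \<open>Q 1\<close>, whereas the cost charges only
  \<open>Q 2\<close> up to \<open>Q (T+1)\<close>; hence the correction in the value formula, which
  disappears for \<open>Q 1 = 0\<close>. The invertibility claim ensures that
  \<open>matrix_inv\<close> denotes a genuine inverse.\<close>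

theorem corollary2:
  fixes T :: nat
    and A :: "nat \<Rightarrow> real^'p^'p" and B :: "nat \<Rightarrow> real^'m^'p" and c :: "nat \<Rightarrow> real^'p"
    and Q :: "nat \<Rightarrow> real^'p^'p" and R :: "nat \<Rightarrow> real^'m^'m"
    and P :: "nat \<Rightarrow> real^'p^'m" and \<alpha> :: "nat \<Rightarrow> real^'m"
    and Z :: "nat \<Rightarrow> real^'p^'p" and \<zeta> :: "nat \<Rightarrow> real^'p" and n :: "nat \<Rightarrow> real"
    and x1 :: "real^'p"
  assumes Q: "\<forall>k\<in>{1..T+1}. pos_semidef (Q k)"
    and R: "\<forall>k\<in>{1..T}. pos_def (R k)"
    and P: "\<forall>k\<in>{1..T}. P k =
      matrix_inv (R k + transpose (B k) ** Z (k+1) ** B k) ** transpose (B k) ** Z (k+1) ** A k"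
    and \<alpha>: "\<forall>k\<in>{1..T}. \<alpha> k =
      (matrix_inv (R k + transpose (B k) ** Z (k+1) ** B k) ** transpose (B k))
        *v (Z (k+1) *v c k + \<zeta> (k+1))"
    and Z_end: "Z (T+1) = Q (T+1)"
    and Z: "\<forall>k\<in>{1..T}. Z k =
      transpose (A k - B k ** P k) ** Z (k+1) ** (A k - B k ** P k)
        + transpose (P k) ** R k ** P k + Q k"
    and \<zeta>_end: "\<zeta> (T+1) = 0"
    and \<zeta>: "\<forall>k\<in>{1..T}. \<zeta> k =
      transpose (A k - B k ** P k) *v (\<zeta> (k+1) + Z (k+1) *v (c k - B k *v \<alpha> k))
        + (transpose (P k) ** R k) *v \<alpha> k"
    and n_end: "n (T+1) = 0"
    and n: "\<forall>k\<in>{1..T}. n k = n (k+1)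
        + 1/2 * ((c k - B k *v \<alpha> k) \<bullet> (Z (k+1) *v (c k - B k *v \<alpha> k)))
        + \<zeta> (k+1) \<bullet> (c k - B k *v \<alpha> k)
        + 1/2 * (\<alpha> k \<bullet> (R k *v \<alpha> k))"
  shows "(\<forall>k\<in>{1..T}. invertible (R k + transpose (B k) ** Z (k+1) ** B k))
    \<and> (\<exists>!u. optimal_control (affine_dyn A B c) (quadratic_cost Q R) T x1 u)
    \<and> (\<forall>\<gamma>. optimal_strategies (affine_dyn A B c) (quadratic_cost Q R) T \<gamma>
          \<longleftrightarrow> (\<forall>k\<in>{1..T}. \<forall>x. \<gamma> k x = - (P k *v x) - \<alpha> k))
    \<and> value_fn (affine_dyn A B c) (quadratic_cost Q R) T 1 x1
        = 1/2 * (x1 \<bullet> (Z 1 *v x1)) + \<zeta> 1 \<bullet> x1 + n 1 - 1/2 * (x1 \<bullet> (Q 1 *v x1))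
    \<and> (Q 1 = 0 \<longrightarrow> value_fn (affine_dyn A B c) (quadratic_cost Q R) T 1 x1
        = 1/2 * (x1 \<bullet> (Z 1 *v x1)) + \<zeta> 1 \<bullet> x1 + n 1)"
proof -
  let ?f = "affine_dyn A B c" and ?g = "quadratic_cost Q R"
  define \<gamma> where "\<gamma> k x = - (P k *v x) - \<alpha> k" for k x
  define W where "W k x = 1/2 * (x \<bullet> (Z k *v x)) + \<zeta> k \<bullet> x + n k - 1/2 * (x \<bullet> (Q k *v x))" for k x
  define M where "M k = R k + transpose (B k) ** Z (k+1) ** B k" for k
  have Z_psd: "pos_semidef (Z k)" if "1 \<le> k" "k \<le> T+1" for k
    by (rule riccati_pos_semidef[where Q = Q and R = R and F = "\<lambda>k. A k - B k ** P k" and P = P])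
      (use Q R Z_end Z that in auto)
  have M_pd: "pos_def (M k)" if "k \<in> {1..T}" for k
    unfolding M_def using that R Z_psd[of "k+1"]
    by (intro pos_def_add_pos_semidef pos_semidef_congruence) auto
  \<comment> \<open>This exact identity gives both Bellman assumptions at once, since
    \<open>M k\<close> is positive definite.\<close>
  have bellman: "?g k (?f k x v) v x + W (Suc k) (?f k x v)
      = W k x + 1/2 * ((v - \<gamma> k x) \<bullet> (M k *v (v - \<gamma> k x)))" if k: "k \<in> {1..T}" for k x v
  proof -
    define d where "d = c k - B k *v \<alpha> k"
    define F where "F = A k - B k ** P k"
    \<comment> \<open>The next state under feedback, used in two forms: this one for stationarity,
      \<open>F *v x + d\<close> for the expansion in \<open>x\<close>.\<close>
    define y where "y = A k *v x + B k *v \<gamma> k x + c k"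
    have sym: "transpose (Z (k+1)) = Z (k+1)" "transpose (R k) = R k"
      using Z_psd[of "k+1"] R k by (auto simp: pos_semidef_def pos_def_def)
    have y: "y = F *v x + d"
      by (simp add: y_def F_def d_def \<gamma>_def matrix_vector_mult_diff_distrib vec.neg
          matrix_vector_mult_diff_rdistrib flip: matrix_vector_mul_assoc)
    have f: "?f k x v = y + B k *v (v - \<gamma> k x)"
      by (simp add: affine_dyn_def y_def matrix_vector_mult_diff_distrib)
    have "transpose (B k) *v (Z (k+1) *v y + \<zeta> (k+1)) + R k *v \<gamma> k x = 0"
      unfolding y_def
      by (rule riccati_minimizer_stationary[where P = "P k" and \<alpha> = "\<alpha> k"])
        (use M_pd[OF k] P \<alpha> k in \<open>auto simp: M_def \<gamma>_def intro: pos_def_imp_invertible\<close>)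
    from stage_cost_complete_square[OF sym this, of "v - \<gamma> k x", folded f M_def]
    have square: "1/2 * (?f k x v \<bullet> (Z (k+1) *v ?f k x v)) + \<zeta> (k+1) \<bullet> ?f k x v
        + 1/2 * (v \<bullet> (R k *v v))
      = 1/2 * (y \<bullet> (Z (k+1) *v y)) + \<zeta> (k+1) \<bullet> y + 1/2 * (\<gamma> k x \<bullet> (R k *v \<gamma> k x))
        + 1/2 * ((v - \<gamma> k x) \<bullet> (M k *v (v - \<gamma> k x)))"
      by simp
    \<comment> \<open>\<open>S\<close> is \<open>Z k\<close> without \<open>Q k\<close>, so it is
      the matrix of the quadratic part of \<open>W k\<close>.\<close>
    define S where "S = transpose F ** Z (k+1) ** F + transpose (P k) ** R k ** P k"
    define \<eta> where "\<eta> = transpose F *v (\<zeta> (k+1) + Z (k+1) *v d) + (transpose (P k) ** R k) *v \<alpha> k"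
    have "Z k = S + Q k" "\<zeta> k = \<eta>" and n_k: "n k = n (k+1)
        + 1/2 * (d \<bullet> (Z (k+1) *v d)) + \<zeta> (k+1) \<bullet> d + 1/2 * (\<alpha> k \<bullet> (R k *v \<alpha> k))"
      using Z \<zeta> n k by (simp_all add: F_def d_def S_def \<eta>_def)
    then have "W k x = 1/2 * (x \<bullet> (S *v x)) + \<eta> \<bullet> x + n k"
      by (simp add: W_def matrix_vector_mult_add_rdistrib inner_add_right field_simps)
    \<comment> \<open>The \<open>Q (k+1)\<close> term charged by the stage cost cancels the one
      subtracted in \<open>W (Suc k)\<close>.\<close>
    moreover have "?g k (?f k x v) v x + W (Suc k) (?f k x v)
      = 1/2 * (?f k x v \<bullet> (Z (k+1) *v ?f k x v)) + \<zeta> (k+1) \<bullet> ?f k x v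
        + 1/2 * (v \<bullet> (R k *v v)) + n (k+1)"
      by (simp add: quadratic_cost_def W_def field_simps)
    ultimately show ?thesis
      using riccati_minimum_value[OF sym, of F x d "\<zeta> (k+1)" "P k" "\<alpha> k",
          folded S_def \<eta>_def y \<gamma>_def] square n_k
      by linarith
  qed
  have form: "0 \<le> h \<bullet> (M k *v h)" "h \<bullet> (M k *v h) = 0 \<longleftrightarrow> h = 0" if "k \<in> {1..T}" for k h
    using M_pd[OF that] pos_def_imp_pos_semidef[OF M_pd[OF that]]
    by (auto simp: pos_def_def pos_semidef_def dest: less_imp_neq[symmetric])
  have le: "W k x \<le> ?g k (?f k x v) v x + W (Suc k) (?f k x v)" if "k \<in> {1..T}" for k x v
    using form(1)[OF that, of "v - \<gamma> k x"] by (simp add: bellman[OF that])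
  have eq: "?g k (?f k x v) v x + W (Suc k) (?f k x v) = W k x \<longleftrightarrow> v = \<gamma> k x"
    if "k \<in> {1..T}" for k x v
    using form(2)[OF that, of "v - \<gamma> k x"] by (simp add: bellman[OF that])
  \<comment> \<open>At stage \<open>T+1\<close> the subtracted \<open>Q\<close> term cancels the
    whole quadratic part, because \<open>Z (T+1) = Q (T+1)\<close>.\<close>
  have terminal: "W (Suc T) x = 0" for x
    using Z_end \<zeta>_end n_end by (simp add: W_def)
  note bellman_facts = terminal le eq
  show ?thesis
    using ex1_optimal_control[of W T ?g ?f \<gamma>, OF bellman_facts]
      optimal_strategies_iff[of W T ?g ?f \<gamma>, OF bellman_facts]
      value_fn_bellman[of W T ?g ?f \<gamma> 1 x1, OF bellman_facts]
      pos_def_imp_invertible[OF M_pd]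
    by (auto simp: \<gamma>_def W_def M_def)
qed

end
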